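(* Let $n$ be a positive integer, let $f:\mathbb{E}\to\mathbb{R}\cup\{+\infty\}$ have Fréchet derivatives $\nabla f(y),\nabla^2 f(y),\dots,\nabla^{n-1}f(y)$ at each point $y\in\mathbb{E}$ of some neighborhood of the point $x\in\mathbb{E}$, and suppose that the $n$-th order Fréchet derivative $\nabla^n f(x)$ exists. Then the lower derivatives of Hadamard type of order $m$ of $f$ at $x$ (taken with respect to $\nabla f(x),\dots,\nabla^{m-1}f(x)$) exist for every integer $m$ with $1\le m\le n$, and the following relations hold for all $u\in\mathbb{E}$: \[ f^{(1)}_-(x;u)=\nabla f(x)(u),\qquad \partial^{(1)}_- f(x)=\{\nabla f(x)\}, \] \[ f^{(m)}_-(x;\nabla f(x),\nabla^2 f(x),\dots,\nabla^{m-1}f(x);u)=\nabla^m f(x)\underbrace{(u)(u)\dots(u)}_{m\text{ times}},\quad m=2,3,\dots,n, \] \[ \nabla^m f(x)\in\partial^{(m)}_- f(x;\nabla f(x),\nabla^2 f(x),\dots,\nabla^{m-1}f(x)),\quad m=2,3,\dots,n. \]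
   Context: $\mathbb{E}$ is a real finite-dimensional Euclidean space. $L^1(\mathbb{E})=L(\mathbb{E},\mathbb{R})$ is the space of continuous linear functionals, and $L^n(\mathbb{E})=L(\mathbb{E},L^{n-1}(\mathbb{E}))$ for $n>1$. A function $f:\mathbb{E}\to\mathbb{R}\cup\{+\infty\}$ is called a proper extended real function (it never takes the value $-\infty$), and $\mathrm{dom}\,f=\{x\in\mathbb{E}\mid f(x)<+\infty\}$. For $x\in\mathrm{dom}\,f$ and $u\in\mathbb{E}$, the lower Hadamard directional derivative is \[ f^{(1)}_-(x;u)=\liminf_{t\downarrow 0,\,u'\to u} t^{-1}[f(x+tu')-f(x)] \] (here $t\to0$ through positive values and $\|u'-u\|\to 0$), and the lower Hadamard subdifferential is $\partial^{(1)}_- f(x)=\{x^*\in L^1(\mathbb{E})\mid x^*(u)\le f^{(1)}_-(x;u)\ \forall u\in\mathbb{E}\}$. Recursively, for an integer $n\ge2$, given $x_1^*\in\partial^{(1)}_- f(x)$ and $x_i^*\in\partial^{(i)}_- f(x;x_1^*,\dots,x_{i-1}^* )$ for $i=2,\dots,n-1$, the lower derivative of Hadamard type of order $n$ is the element of $[-\infty,+\infty]$ \[ f^{(n)}_-(x;x_1^*,\dots,x_{n-1}^*;u)=\liminf_{t\downarrow0,\,u'\to u} n!\,t^{-n}\Big[f(x+tu')-f(x)-\sum_{i=1}^{n-1}\frac{t^i}{i!}\,x_i^*\underbrace{(u')\dots(u')}_{i\text{ times}}\Big], \] and the lower subdifferential of Hadamard type of order $n$ is \[ \partial^{(n)}_-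 f(x;x_1^*,\dots,x_{n-1}^* )=\{x^*\in L^n(\mathbb{E})\mid x^*\underbrace{(u)\dots(u)}_{n\text{ times}}\le f^{(n)}_-(x;x_1^*,\dots,x_{n-1}^*;u)\ \forall u\in\mathbb{E}\}. \] *)

theory Defs
  imports "HOL-Analysis.Analysis"
begin

text \<open>
  The spaces \<open>L\<^sup>n(E)\<close> have different types for different \<open>n\<close>. To let \<open>n\<close> be a variable, an element
  \<open>A\<close> of \<open>L\<^sup>n(E)\<close> is represented by the function taking a list \<open>[u\<^sub>1, \<dots>, u\<^sub>n]\<close> to \<open>A(u\<^sub>1)\<dots>(u\<^sub>n)\<close>, and
  taking lists of any other length to \<open>0\<close>, so that equality of representations is equality in
  \<open>L\<^sup>n(E)\<close>.  The value \<open>A(u) \<in> L\<^sup>n\<^sup>-\<^sup>1(E)\<close> is then \<open>ev A u\<close>, and the vector space operations are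
  pointwise. The recursions start from \<open>L\<^sup>0(E) = \<real>\<close>.
\<close>

type_synonym 'a form = "'a list \<Rightarrow> real"

definition ev :: "'a form \<Rightarrow> 'a \<Rightarrow> 'a form" where
  "ev A u = (\<lambda>us. A (u # us))"

text \<open>The operator norm of \<open>L(E, L\<^sup>n\<^sup>-\<^sup>1(E))\<close>.\<close>

primrec form_norm :: "nat \<Rightarrow> 'a::euclidean_space form \<Rightarrow> real" where
  "form_norm 0 A = \<bar>A []\<bar>"
| "form_norm (Suc n) A = (SUP u\<in>cball 0 1. form_norm n (ev A u))"

text \<open>The last two conjuncts say that \<open>u \<mapsto> A(u)\<close> is linear and continuous into \<open>L\<^sup>n(E)\<close>.\<close>

primrec forms :: "nat \<Rightarrow> 'a::euclidean_space form set" where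
  "forms 0 = {A. \<forall>us. us \<noteq> [] \<longrightarrow> A us = 0}"
| "forms (Suc n) = {A. A [] = 0 \<and> (\<forall>u. ev A u \<in> forms n) \<and>
     (\<forall>us. linear (\<lambda>u. ev A u us)) \<and>
     (\<exists>K. \<forall>u. form_norm n (ev A u) \<le> K * norm u)}"

definition form_has_derivative ::
    "nat \<Rightarrow> ('a::euclidean_space \<Rightarrow> 'a form) \<Rightarrow> 'a form \<Rightarrow> 'a \<Rightarrow> bool" where
  "form_has_derivative n G A x \<longleftrightarrow> A \<in> forms (Suc n) \<and>
     ((\<lambda>h. form_norm n (\<lambda>us. G (x + h) us - G x us - ev A h us) / norm h) \<longlongrightarrow> 0) (at 0)"

text \<open>
  \<open>has_nabla n f x A\<close>: the \<open>n\<close>-th order derivative of \<open>f\<close> at \<open>x\<close> exists and equals \<open>A\<close>. For \<open>n = 0\<close>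
  this says that \<open>f\<close> is finite at \<open>x\<close> with value \<open>A\<close>; hence \<open>f\<close> is finite near any point where it
  has a derivative of positive order. \<open>G\<close> is the derivative of order \<open>n\<close>, which has to exist on
  a neighbourhood of \<open>x\<close>.
\<close>

primrec has_nabla :: "nat \<Rightarrow> ('a::euclidean_space \<Rightarrow> ereal) \<Rightarrow> 'a \<Rightarrow> 'a form \<Rightarrow> bool" where
  "has_nabla 0 f x A \<longleftrightarrow>
     \<bar>f x\<bar> \<noteq> \<infinity> \<and> A = (\<lambda>us. if us = [] then real_of_ereal (f x) else 0)"
| "has_nabla (Suc n) f x A \<longleftrightarrow>
     (\<exists>G. (\<forall>\<^sub>F y in nhds x. has_nabla n f y (G y)) \<and> form_has_derivative n G A x)"

definition frechet_differentiable :: "nat \<Rightarrow> ('a::euclidean_space \<Rightarrow> ereal) \<Rightarrow> 'a \<Rightarrow> bool" where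
  "frechet_differentiable n f x \<longleftrightarrow> (\<exists>A. has_nabla n f x A)"

definition nabla :: "nat \<Rightarrow> ('a::euclidean_space \<Rightarrow> ereal) \<Rightarrow> 'a \<Rightarrow> 'a form" where
  "nabla n f x = (THE A. has_nabla n f x A)"

definition proper_fun :: "('a \<Rightarrow> ereal) \<Rightarrow> bool" where
  "proper_fun f \<longleftrightarrow> (\<forall>x. f x \<noteq> -\<infinity>)"

definition eff_dom :: "('a \<Rightarrow> ereal) \<Rightarrow> 'a set" where
  "eff_dom f = {x. f x < \<infinity>}"

text \<open>
  The list \<open>xs = [x\<^sub>1\<^sup>*, \<dots>, x\<^sub>n\<^sub>-\<^sub>1\<^sup>*]\<close> determines the order \<open>n = length xs + 1\<close>; \<open>xs = []\<close> gives the
  first-order notions. In the filter, \<open>u'\<close> may be equal to \<open>u\<close>.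
\<close>

definition lower_deriv ::
    "('a::euclidean_space \<Rightarrow> ereal) \<Rightarrow> 'a \<Rightarrow> 'a form list \<Rightarrow> 'a \<Rightarrow> ereal" where
  "lower_deriv f x xs u = (let n = Suc (length xs) in
     Liminf (at_right 0 \<times>\<^sub>F nhds u) (\<lambda>(t, u').
       ereal (fact n / t ^ n) * (f (x + t *\<^sub>R u') - f x
         - ereal (\<Sum>i=1..n - 1. t ^ i / fact i * (xs ! (i - 1)) (replicate i u')))))"

definition lower_subdiff ::
    "('a::euclidean_space \<Rightarrow> ereal) \<Rightarrow> 'a \<Rightarrow> 'a form list \<Rightarrow> 'a form set" where
  "lower_subdiff f x xs = (let n = Suc (length xs) in
     {A \<in> forms n. \<forall>u. ereal (A (replicate n u)) \<le> lower_deriv f x xs u})"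

text \<open>
  The lower derivative and subdifferential with respect to \<open>xs\<close> are only meaningful
  (\<open>exist\<close>) if \<open>x \<in> eff_dom f\<close> and each \<open>x\<^sub>i\<^sup>*\<close> lies in the subdifferential of order \<open>i\<close> with respect to
  its predecessors.
\<close>

definition lower_deriv_exists ::
    "('a::euclidean_space \<Rightarrow> ereal) \<Rightarrow> 'a \<Rightarrow> 'a form list \<Rightarrow> bool" where
  "lower_deriv_exists f x xs \<longleftrightarrow>
     x \<in> eff_dom f \<and> (\<forall>i<length xs. xs ! i \<in> lower_subdiff f x (take i xs))"

definition nablas :: "nat \<Rightarrow> ('a::euclidean_space \<Rightarrow> ereal) \<Rightarrow> 'a \<Rightarrow> 'a form list" where
  "nablas k f x = map (\<lambda>i. nabla i f x) [1..<Suc k]"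

subsection \<open>Uniqueness of derivatives\<close>

lemma form_norm_bdd:
  assumes "C \<in> forms (Suc n)"
  shows "bdd_above ((\<lambda>u. form_norm n (ev C u)) ` cball 0 1)"
proof -
  obtain K where K: "\<And>u. form_norm n (ev C u) \<le> K * norm u" using assms by auto
  have "form_norm n (ev C u) \<le> \<bar>K\<bar>" if "u \<in> cball 0 1" for u
  proof -
    have "K * norm u \<le> \<bar>K\<bar> * 1" by (rule mult_mono) (use that in auto)
    with K[of u] show ?thesis by simp
  qed
  then show ?thesis by (auto intro!: bdd_aboveI2)
qed

lemma form_norm_nonneg_diff:
  "A \<in> forms n \<Longrightarrow> B \<in> forms n \<Longrightarrow>
    0 \<le> form_norm n A \<and> (\<lambda>us. A us - B us) \<in> forms n \<and>
    form_norm n (\<lambda>us. A us - B us) \<le> form_norm n A + form_norm n B"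
proof (induction n arbitrary: A B)
  case 0
  then show ?case by auto
next
  case (Suc n)
  have sub: "ev (\<lambda>us. A us - B us) u = (\<lambda>us. ev A u us - ev B u us)" for u
    by (simp add: ev_def)
  have inA: "ev A u \<in> forms n" and inB: "ev B u \<in> forms n" for u using Suc.prems by auto
  note IH = Suc.IH[OF inA inB] and IHA = Suc.IH[OF inA inA]
  have up: "form_norm n (ev C u) \<le> form_norm (Suc n) C" if "C \<in> forms (Suc n)" "u \<in> cball 0 1" for C u
    using cSUP_upper[OF that(2) form_norm_bdd[OF that(1)]] by simp
  have nn: "0 \<le> form_norm (Suc n) A" using order_trans[OF _ up[OF Suc.prems(1), of 0]] IH[of 0] by simp
  have tri: "form_norm (Suc n) (\<lambda>us. A us - B us) \<le> form_norm (Suc n) A + form_norm (Suc n) B"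
    unfolding form_norm.simps(2)[of n "\<lambda>us. A us - B us"] sub
  proof (rule cSUP_least)
    fix u :: 'a assume u: "u \<in> cball 0 1"
    show "form_norm n (\<lambda>us. ev A u us - ev B u us) \<le> form_norm (Suc n) A + form_norm (Suc n) B"
      using IH[of u u] up[OF Suc.prems(1) u] up[OF Suc.prems(2) u] by linarith
  qed auto
  obtain K L where K: "\<And>u. form_norm n (ev A u) \<le> K * norm u"
    and L: "\<And>u. form_norm n (ev B u) \<le> L * norm u" using Suc.prems by auto
  have "form_norm n (\<lambda>us. ev A u us - ev B u us) \<le> (K + L) * norm u" for u
    using IH[of u u] K[of u] L[of u] by (simp add: distrib_right)
  then have ex: "\<exists>K. \<forall>u. form_norm n (\<lambda>us. ev A u us - ev B u us) \<le> K * norm u" by blast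
  have "(\<lambda>us. A us - B us) \<in> forms (Suc n)"
    using Suc.prems IH ex by (auto simp: sub intro!: linear_compose_sub)
  with nn tri show ?case by blast
qed

lemmas forms_diff = form_norm_nonneg_diff[THEN conjunct2, THEN conjunct1]

lemma form_norm_upper:
  "C \<in> forms (Suc n) \<Longrightarrow> norm u \<le> 1 \<Longrightarrow> form_norm n (ev C u) \<le> form_norm (Suc n) C"
  using cSUP_upper[OF _ form_norm_bdd, of u C n] by simp

lemma forms_apply_bound:
  "A \<in> forms n \<Longrightarrow> length us = n \<Longrightarrow>
    \<bar>A us\<bar> \<le> form_norm n A * prod_list (map norm us)"
proof (induction n arbitrary: A us)
  case 0
  then show ?case by simp
next
  case (Suc n)
  obtain u vs where us: "us = u # vs" "length vs = n" using Suc.prems(2) by (cases us) auto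
  define v where "v = sgn u"
  have v: "norm v \<le> 1" "u = norm u *\<^sub>R v"
    by (cases "u = 0"; simp add: v_def norm_sgn sgn_div_norm)+
  have "linear (\<lambda>u. A (u # vs))" using Suc.prems(1) by (simp add: ev_def)
  then have "A us = norm u * ev A v vs"
    using linear_scale[of "\<lambda>u. A (u # vs)" "norm u" v] v(2) by (simp add: us ev_def)
  also have "\<bar>\<dots>\<bar> = norm u * \<bar>ev A v vs\<bar>" by (simp add: abs_mult)
  also have "\<bar>ev A v vs\<bar> \<le> form_norm n (ev A v) * prod_list (map norm vs)"
    using Suc.IH Suc.prems(1) us(2) by simp
  also have "\<dots> \<le> form_norm (Suc n) A * prod_list (map norm vs)"
    using form_norm_upper[OF Suc.prems(1) v(1)]
    by (rule mult_right_mono) (auto intro!: prod_list_nonneg)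
  finally have "\<bar>A us\<bar> \<le> norm u * (form_norm (Suc n) A * prod_list (map norm vs))"
    by (simp add: mult_left_mono)
  then show ?case by (simp add: us mult_ac)
qed

lemma forms_zero: "A \<in> forms n \<Longrightarrow> length us \<noteq> n \<Longrightarrow> A us = 0"
proof (induction n arbitrary: A us)
  case (Suc n)
  show ?case
  proof (cases us)
    case (Cons u vs)
    then have "ev A u vs = 0" using Suc.IH Suc.prems by simp
    then show ?thesis by (simp add: ev_def Cons)
  qed (use Suc.prems in simp)
qed auto

lemma form_has_derivative_apply:
  assumes D: "form_has_derivative n G A x" and G: "\<forall>\<^sub>F y in nhds x. G y \<in> forms n"
    and us: "length us = n"
  shows "((\<lambda>y. G y us) has_derivative (\<lambda>h. A (h # us))) (at x)"
proof -
  have A: "A \<in> forms (Suc n)"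
    and lim: "((\<lambda>h. form_norm n (\<lambda>us. G (x + h) us - G x us - ev A h us) / norm h) \<longlongrightarrow> 0) (at 0)"
    using D by (auto simp: form_has_derivative_def)
  define P where "P = prod_list (map norm us)"
  have "filterlim (\<lambda>h. x + h) (nhds x) (at 0)" by (auto intro!: tendsto_eq_intros)
  from eventually_compose_filterlim[OF G this] have ev1: "\<forall>\<^sub>F h in at 0. G (x + h) \<in> forms n" .
  have Gx: "G x \<in> forms n" using G by (rule eventually_nhds_x_imp_x)
  have lim0: "((\<lambda>h. (G (x + h) us - G x us - A (h # us)) /\<^sub>R norm h) \<longlongrightarrow> 0) (at 0)"
  proof (rule Lim_null_comparison)
    show "\<forall>\<^sub>F h in at 0. norm ((G (x + h) us - G x us - A (h # us)) /\<^sub>R norm h)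
        \<le> form_norm n (\<lambda>us. G (x + h) us - G x us - ev A h us) / norm h * P"
      using ev1
    proof eventually_elim
      case (elim h)
      have "ev A h \<in> forms n" using A by simp
      from forms_apply_bound[OF forms_diff[OF forms_diff[OF elim Gx] this] us]
      have "\<bar>G (x + h) us - G x us - A (h # us)\<bar>
          \<le> form_norm n (\<lambda>us. G (x + h) us - G x us - ev A h us) * P"
        by (simp add: P_def ev_def)
      from divide_right_mono[OF this norm_ge_zero[of h]] show ?case
        by (simp add: abs_mult divide_inverse mult_ac)
    qed
    show "((\<lambda>h. form_norm n (\<lambda>us. G (x + h) us - G x us - ev A h us) / norm h * P) \<longlongrightarrow> 0) (at 0)"
      using tendsto_mult_left_zero[OF lim] .
  qed
  have "bounded_linear (\<lambda>h. A (h # us))"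
    using A by (simp add: ev_def linear_conv_bounded_linear)
  moreover have "((\<lambda>h. norm (G (x + h) us - G x us - A (h # us)) / norm h) \<longlongrightarrow> 0) (at 0)"
    using tendsto_norm_zero[OF lim0] by (simp add: divide_inverse_commute abs_mult)
  ultimately show ?thesis by (simp add: has_derivative_at)
qed

lemma has_nabla_forms: "has_nabla n f x A \<Longrightarrow> A \<in> forms n"
  by (cases n) (auto simp: form_has_derivative_def simp del: forms.simps(2))

lemma has_nabla_unique: "has_nabla n f x A \<Longrightarrow> has_nabla n f x B \<Longrightarrow> A = B"
proof (induction n arbitrary: x A B)
  case 0
  then show ?case by simp
next
  case (Suc n)
  obtain G where G: "\<forall>\<^sub>F y in nhds x. has_nabla n f y (G y)" "form_has_derivative n G A x"
    using Suc.prems(1) by auto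
  obtain H where H: "\<forall>\<^sub>F y in nhds x. has_nabla n f y (H y)" "form_has_derivative n H B x"
    using Suc.prems(2) by auto
  have GH: "\<forall>\<^sub>F y in nhds x. G y = H y"
    using G(1) H(1) by eventually_elim (rule Suc.IH)
  have AB: "A \<in> forms (Suc n)" "B \<in> forms (Suc n)" using Suc.prems has_nabla_forms by blast+
  show ?case
  proof
    fix us
    show "A us = B us"
    proof (cases "length us = Suc n")
      case True
      then obtain u vs where us: "us = u # vs" "length vs = n" by (cases us) auto
      have dG: "((\<lambda>y. G y vs) has_derivative (\<lambda>h. A (h # vs))) (at x)"
        using G us(2) by (intro form_has_derivative_apply[where n = n])
          (auto elim: eventually_mono intro: has_nabla_forms)
      have dH: "((\<lambda>y. H y vs) has_derivative (\<lambda>h. B (h # vs))) (at x)"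
        using H us(2) by (intro form_has_derivative_apply[where n = n])
          (auto elim: eventually_mono intro: has_nabla_forms)
      have "((\<lambda>y. G y vs) has_derivative (\<lambda>h. B (h # vs))) (at x)"
        by (rule has_derivative_transform_eventually[OF dH])
          (use GH in \<open>auto elim: eventually_mono simp: eventually_at_filter
             dest: eventually_nhds_x_imp_x\<close>)
      from has_derivative_unique[OF dG this] show ?thesis by (simp add: us fun_eq_iff)
    qed (use AB forms_zero in metis)
  qed
qed

lemma nabla_eq: "has_nabla n f x A \<Longrightarrow> nabla n f x = A"
  unfolding nabla_def using has_nabla_unique by blast

lemma has_nabla_nabla: "frechet_differentiable n f x \<Longrightarrow> has_nabla n f x (nabla n f x)"
  unfolding frechet_differentiable_def using nabla_eq by metis

end

theory Submission
  imports Defs "HOL-Library.Landau_Symbols"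
begin

text \<open>
  The difference quotient that defines the lower derivative of order \<open>m\<close> is a rescaled Taylor
  remainder.  So everything follows from Taylor's formula with Peano remainder: if \<open>f\<close> has a
  derivative of order \<open>m\<close> at \<open>x\<close>, then \<open>f(x + w)\<close> differs from its Taylor polynomial of order \<open>m\<close>
  by \<open>o(norm w ^ m)\<close> (\<open>Taylor_Peano\<close>).  With \<open>w = t *\<^sub>R u'\<close>, and the polynomial of order \<open>m - 1\<close>
  subtracted, the quotient is \<open>\<nabla>\<^sup>m f(x)(u')\<dots>(u') + o(1)\<close> as \<open>t\<close> tends to \<open>0\<close> from above and \<open>u'\<close>
  tends to \<open>u\<close>.  Hence it has a genuine limit, and the lower limit is that limit
  (\<open>lower_deriv_nablas\<close>).  The membership of each derivative in its subdifferential is then an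
  equality case of the defining inequality.  For \<open>m = 1\<close> the subdifferential has no other element,
  because a linear functional that lies below another one everywhere equals it, as one sees by
  comparing them at \<open>u\<close> and \<open>- u\<close>.

  Taylor's formula is proved along the segments from \<open>x\<close> to \<open>x + w\<close>, where it is a statement about
  functions of a real variable.  The \<open>k\<close>-th derivative of \<open>s \<mapsto> f(x + s w)\<close> is
  \<open>\<nabla>\<^sup>k f(x + s w)(w)\<dots>(w)\<close>, a diagonal value as in the Taylor polynomial, whereas differentiating
  \<open>w \<mapsto> \<nabla>\<^sup>k f(x)(w)\<dots>(w)\<close> in other directions would produce mixed arguments.  The highest derivative
  is available only at \<open>x\<close> itself, so the expansion with Lagrange remainder is stopped one order
  earlier, and the definition of the derivative at \<open>x\<close>, whose error bound is uniform in all
  directions, is applied to that remainder.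
\<close>

section \<open>Multilinear forms on the diagonal\<close>

lemma forms_linear: "A \<in> forms (Suc n) \<Longrightarrow> linear (\<lambda>u. A (u # us))"
  by (simp add: ev_def)

lemma forms_diagonal_scaleR:
  "A \<in> forms n \<Longrightarrow> A (replicate n (t *\<^sub>R u)) = t ^ n * A (replicate n u)"
proof (induction n arbitrary: A)
  case (Suc n)
  have "A (replicate (Suc n) (t *\<^sub>R u)) = t * ev A u (replicate n (t *\<^sub>R u))"
    using linear_scale[OF forms_linear[OF Suc.prems]] by (simp add: ev_def)
  also have "\<dots> = t ^ Suc n * ev A u (replicate n u)"
    using Suc by simp
  finally show ?case by (simp add: ev_def)
qed simp

text \<open>
  In finite dimension, expanding the first argument in a basis writes the diagonal values of \<open>A\<close>
  as a finite sum of products of coordinates with diagonal values of forms of lower order.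
\<close>

lemma forms_diagonal_isCont:
  "A \<in> forms n \<Longrightarrow> isCont (\<lambda>u. A (replicate n u)) (u :: 'a::euclidean_space)"
proof (induction n arbitrary: A)
  case (Suc n)
  have "A (v # vs) = (\<Sum>b\<in>Basis. (v \<bullet> b) * ev A b vs)" for v vs
  proof -
    have lin: "linear (\<lambda>u. A (u # vs))" by (rule forms_linear[OF Suc.prems])
    have "A (v # vs) = A ((\<Sum>b\<in>Basis. (v \<bullet> b) *\<^sub>R b) # vs)"
      by (simp add: euclidean_representation)
    also have "\<dots> = (\<Sum>b\<in>Basis. (v \<bullet> b) * ev A b vs)"
      by (simp add: linear_sum[OF lin] linear_scale[OF lin] ev_def)
    finally show ?thesis .
  qed
  then have "(\<lambda>u. A (replicate (Suc n) u)) = (\<lambda>u. \<Sum>b\<in>Basis. (u \<bullet> b) * ev A b (replicate n u))"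
    by simp
  moreover have "isCont (\<lambda>u. ev A b (replicate n u)) u" for b
    using Suc by simp
  ultimately show ?case by (auto intro!: continuous_intros)
qed simp

section \<open>Derivatives of all lower orders\<close>

lemma eventually_nhds_shift:
  fixes x :: "'a::real_normed_vector"
  assumes "\<forall>\<^sub>F y in nhds x. P y"
  shows "\<forall>\<^sub>F h in nhds 0. P (x + h)"
proof -
  have "filterlim (\<lambda>h. x + h) (nhds x) (nhds 0)"
    using tendsto_add[OF tendsto_const[of x] filterlim_ident[of "nhds 0"]] by simp
  with assms show ?thesis by (rule eventually_compose_filterlim)
qed

text \<open>
  Since derivatives are unique, the derivative of order \<open>n\<close> near \<open>x\<close>, which the recursion only
  claims to exist, may be taken to be \<open>nabla n f\<close>.  This makes the derivatives of different orders
  successive derivatives of one family of functions.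
\<close>

lemma has_nabla_Suc_iff:
  "has_nabla (Suc n) f x A \<longleftrightarrow>
    (\<forall>\<^sub>F y in nhds x. frechet_differentiable n f y) \<and> form_has_derivative n (nabla n f) A x"
proof
  assume "has_nabla (Suc n) f x A"
  then obtain G where G: "\<forall>\<^sub>F y in nhds x. has_nabla n f y (G y)" "form_has_derivative n G A x"
    by auto
  have GN: "\<forall>\<^sub>F y in nhds x. G y = nabla n f y"
    using G(1) by eventually_elim (simp add: nabla_eq)
  have "\<forall>\<^sub>F h in at 0. G (x + h) = nabla n f (x + h)"
    using eventually_nhds_shift[OF GN] by (simp add: eventually_at_filter eventually_mono)
  then have "\<forall>\<^sub>F h in at 0. form_norm n (\<lambda>us. G (x + h) us - G x us - ev A h us) / norm h
      = form_norm n (\<lambda>us. nabla n f (x + h) us - nabla n f x us - ev A h us) / norm h"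
    by eventually_elim (simp add: eventually_nhds_x_imp_x[OF GN])
  from tendsto_cong[OF this] have "form_has_derivative n (nabla n f) A x"
    using G(2) by (simp only: form_has_derivative_def)
  moreover have "\<forall>\<^sub>F y in nhds x. frechet_differentiable n f y"
    using G(1) by eventually_elim (auto simp: frechet_differentiable_def)
  ultimately show "(\<forall>\<^sub>F y in nhds x. frechet_differentiable n f y) \<and>
      form_has_derivative n (nabla n f) A x" by blast
next
  assume "(\<forall>\<^sub>F y in nhds x. frechet_differentiable n f y) \<and> form_has_derivative n (nabla n f) A x"
  then show "has_nabla (Suc n) f x A"
    by (auto elim!: eventually_mono intro!: exI[of _ "nabla n f"] has_nabla_nabla)
qed

lemma frechet_differentiable_mono:
  "frechet_differentiable n f x \<Longrightarrow> k \<le> n \<Longrightarrow> frechet_differentiable k f x"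
proof (induction n)
  case (Suc n)
  then have "frechet_differentiable n f x"
    by (auto simp: frechet_differentiable_def[of "Suc n"] has_nabla_Suc_iff
        simp del: has_nabla.simps dest: eventually_nhds_x_imp_x)
  with Suc show ?case by (cases "k = Suc n") auto
qed simp

lemma nabla_forms: "frechet_differentiable n f x \<Longrightarrow> nabla n f x \<in> forms n"
  by (rule has_nabla_forms[OF has_nabla_nabla])

lemma frechet_differentiable_finite:
  assumes "frechet_differentiable n f x"
  shows "f x = ereal (nabla 0 f x [])"
  using has_nabla_nabla[OF frechet_differentiable_mono[OF assms, of 0]]
  by (auto simp: ereal_real')

lemma nabla_has_derivative:
  assumes "has_nabla (Suc n) f x A" and "length us = n"
  shows "((\<lambda>y. nabla n f y us) has_derivative (\<lambda>h. A (h # us))) (at x)"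
  using assms by (intro form_has_derivative_apply[where n = n])
    (auto simp: has_nabla_Suc_iff simp del: has_nabla.simps elim: eventually_mono intro: nabla_forms)

lemma nabla_line_has_real_derivative:
  assumes "frechet_differentiable (Suc k) f (x + s *\<^sub>R w)" and "length us = k"
  shows "((\<lambda>s. nabla k f (x + s *\<^sub>R w) us) has_real_derivative
    nabla (Suc k) f (x + s *\<^sub>R w) (w # us)) (at s)"
proof -
  let ?A = "nabla (Suc k) f (x + s *\<^sub>R w)"
  have "((\<lambda>s. x + s *\<^sub>R w) has_derivative (\<lambda>h. h *\<^sub>R w)) (at s)"
    by (auto intro!: derivative_eq_intros)
  from has_derivative_compose[OF this nabla_has_derivative[OF has_nabla_nabla[OF assms(1)] assms(2)]]
  have "((\<lambda>s. nabla k f (x + s *\<^sub>R w) us) has_derivative (\<lambda>h. ?A ((h *\<^sub>R w) # us))) (at s)" .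
  moreover have "?A ((h *\<^sub>R w) # us) = ?A (w # us) * h" for h
    using linear_scale[OF forms_linear[OF nabla_forms[OF assms(1)]]] by simp
  ultimately show ?thesis by (simp add: has_field_derivative_def)
qed

section \<open>Taylor's formula with Peano remainder\<close>

text \<open>
  The error in the definition of the derivative is measured in \<open>form_norm\<close>.  This gives one
  neighbourhood of \<open>0\<close> that serves all argument lists \<open>us\<close> at once.
\<close>

lemma nabla_increment:
  assumes A: "has_nabla (Suc m) f x A" and e: "0 < e"
  shows "\<forall>\<^sub>F h in nhds 0. \<forall>us. length us = m \<longrightarrow>
    \<bar>nabla m f (x + h) us - nabla m f x us - A (h # us)\<bar> \<le> e * norm h * prod_list (map norm us)"
proof -
  have D: "form_has_derivative m (nabla m f) A x"
    and fd: "\<forall>\<^sub>F y in nhds x. frechet_differentiable m f y"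
    using A by (auto simp: has_nabla_Suc_iff simp del: has_nabla.simps)
  have AF: "A \<in> forms (Suc m)" using A by (rule has_nabla_forms)
  have "((\<lambda>h. form_norm m (\<lambda>us. nabla m f (x + h) us - nabla m f x us - ev A h us) / norm h)
      \<longlongrightarrow> 0) (at 0)"
    using D by (simp add: form_has_derivative_def)
  from order_tendstoD(2)[OF this e]
  have small: "\<forall>\<^sub>F h in nhds 0. h \<noteq> 0 \<longrightarrow>
      form_norm m (\<lambda>us. nabla m f (x + h) us - nabla m f x us - ev A h us) / norm h < e"
    by (simp add: eventually_at_filter)
  from eventually_nhds_shift[OF fd]
  have fd': "\<forall>\<^sub>F h in nhds 0. frechet_differentiable m f (x + h)" .
  from small fd' show ?thesis
  proof eventually_elim
    case (elim h)
    let ?B = "\<lambda>us. nabla m f (x + h) us - nabla m f x us - ev A h us"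
    show ?case
    proof (intro allI impI)
      fix us :: "'a list" assume us: "length us = m"
      show "\<bar>nabla m f (x + h) us - nabla m f x us - A (h # us)\<bar> \<le> e * norm h * prod_list (map norm us)"
      proof (cases "h = 0")
        case True
        then show ?thesis using linear_0[OF forms_linear[OF AF]] by simp
      next
        case False
        have "?B \<in> forms m"
          using AF by (intro forms_diff nabla_forms elim eventually_nhds_x_imp_x[OF fd]) auto
        from forms_apply_bound[OF this us]
        have "\<bar>?B us\<bar> \<le> form_norm m ?B * prod_list (map norm us)" .
        also have "\<dots> \<le> e * norm h * prod_list (map norm us)"
          using elim(1) False
          by (intro mult_right_mono) (auto simp: field_simps intro!: prod_list_nonneg)
        finally show ?thesis by (simp add: ev_def)
      qed
    qed
  qed
qed

text \<open>
  Lagrange's formula of order \<open>m\<close> on the segment from \<open>x\<close> to \<open>x + w\<close>, for the function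
  \<open>s \<mapsto> f(x + s w) - a s ^ Suc m / fact (Suc m)\<close>.  Its \<open>m\<close>-th derivative contains \<open>- s * a\<close>, which for
  \<open>a = \<nabla>\<^sup>m\<^sup>+\<^sup>1 f(x)(w)\<dots>(w)\<close> is exactly the linear part of the increment of \<open>\<nabla>\<^sup>m f\<close>.  Without this
  correction the unknown intermediate point \<open>s\<close> would spoil the coefficient of order \<open>Suc m\<close>.
\<close>

lemma nabla_Taylor_segment:
  assumes fd: "\<And>s. 0 \<le> s \<Longrightarrow> s \<le> 1 \<Longrightarrow> frechet_differentiable m f (x + s *\<^sub>R w)"
  obtains s where "0 < s" "s \<le> 1"
    "nabla 0 f (x + w) [] - (\<Sum>k\<le>m. nabla k f x (replicate k w) / fact k) - a / fact (Suc m)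
      = (nabla m f (x + s *\<^sub>R w) (replicate m w) - nabla m f x (replicate m w) - s * a) / fact m"
proof -
  define diff where "diff = (\<lambda>k s. nabla k f (x + s *\<^sub>R w) (replicate k w)
      - a * s ^ (Suc m - k) / fact (Suc m - k))"
  have deriv: "(diff k has_real_derivative diff (Suc k) s) (at s)"
    if k: "k < m" and s: "0 \<le> s" "s \<le> 1" for k s
  proof -
    have "frechet_differentiable (Suc k) f (x + s *\<^sub>R w)"
      using fd[OF s] k by (elim frechet_differentiable_mono) simp
    from nabla_line_has_real_derivative[OF this, of "replicate k w"]
    have 1: "((\<lambda>s. nabla k f (x + s *\<^sub>R w) (replicate k w)) has_real_derivative
        nabla (Suc k) f (x + s *\<^sub>R w) (replicate (Suc k) w)) (at s)" by simp
    define j where "j = m - k"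
    have j: "Suc m - k = Suc j" "Suc m - Suc k = j" using k by (auto simp: j_def)
    have "((\<lambda>s. a * s ^ Suc j / fact (Suc j)) has_real_derivative
        a * (real (Suc j) * s ^ j) / fact (Suc j)) (at s)"
      by (rule derivative_eq_intros refl | simp)+
    also have "a * (real (Suc j) * s ^ j) / fact (Suc j) = a * s ^ j / fact j"
      by (simp add: field_simps del: of_nat_Suc)
    finally show ?thesis unfolding diff_def j by (intro DERIV_diff 1)
  qed
  obtain s where s: "0 < s" "s \<le> 1"
    and eq: "diff 0 1 = (\<Sum>k<m. diff k 0 / fact k * 1 ^ k) + diff m s / fact m * 1 ^ m"
    using Maclaurin2[of 1 diff "diff 0" m] deriv by auto
  have "diff k 0 = nabla k f x (replicate k w)" if "k < m" for k
    using that by (simp add: diff_def)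
  then have "(\<Sum>k<m. diff k 0 / fact k * 1 ^ k) = (\<Sum>k<m. nabla k f x (replicate k w) / fact k)"
    by (intro sum.cong) auto
  with eq s show ?thesis
    by (intro that[of s]) (simp_all add: diff_def lessThan_Suc_atMost[symmetric] diff_divide_distrib mult.commute)
qed

theorem Taylor_Peano:
  assumes A: "frechet_differentiable (Suc m) f x"
  shows "(\<lambda>w. nabla 0 f (x + w) [] - (\<Sum>k\<le>Suc m. nabla k f x (replicate k w) / fact k))
    \<in> o[nhds 0](\<lambda>w. norm w ^ Suc m)"
proof (rule landau_o.smallI)
  fix e :: real assume e: "0 < e"
  let ?A = "nabla (Suc m) f x"
  note HA = has_nabla_nabla[OF A]
  have "\<forall>\<^sub>F y in nhds x. frechet_differentiable m f y"
    using HA by (auto simp: has_nabla_Suc_iff simp del: has_nabla.simps)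
  from eventually_nhds_shift[OF this]
  have "\<forall>\<^sub>F h in nhds 0. frechet_differentiable m f (x + h)" .
  with nabla_increment[OF HA e]
  have "\<forall>\<^sub>F h in nhds 0. frechet_differentiable m f (x + h) \<and> (\<forall>us. length us = m \<longrightarrow>
      \<bar>nabla m f (x + h) us - nabla m f x us - ?A (h # us)\<bar> \<le> e * norm h * prod_list (map norm us))"
    by eventually_elim auto
  then obtain d where d: "0 < d" and dfd: "\<And>h. norm h < d \<Longrightarrow> frechet_differentiable m f (x + h)"
    and dinc: "\<And>h us. norm h < d \<Longrightarrow> length us = m \<Longrightarrow>
      \<bar>nabla m f (x + h) us - nabla m f x us - ?A (h # us)\<bar> \<le> e * norm h * prod_list (map norm us)"
    unfolding eventually_nhds_metric by (auto simp: dist_norm)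
  have "\<forall>\<^sub>F w in nhds 0. norm (w :: 'a) < d"
    using d unfolding eventually_nhds_metric by (auto simp: dist_norm)
  then show "\<forall>\<^sub>F w in nhds 0.
      norm (nabla 0 f (x + w) [] - (\<Sum>k\<le>Suc m. nabla k f x (replicate k w) / fact k))
        \<le> e * norm (norm w ^ Suc m)"
  proof eventually_elim
    case (elim w)
    have seg: "norm (s *\<^sub>R w) < d" if "0 \<le> s" "s \<le> 1" for s
      using that elim mult_right_mono[of s 1 "norm w"] by simp
    define a where "a = ?A (replicate (Suc m) w)"
    obtain s where s: "0 < s" "s \<le> 1" and
      eq: "nabla 0 f (x + w) [] - (\<Sum>k\<le>m. nabla k f x (replicate k w) / fact k) - a / fact (Suc m)
        = (nabla m f (x + s *\<^sub>R w) (replicate m w) - nabla m f x (replicate m w) - s * a) / fact m"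
      by (rule nabla_Taylor_segment[of m f x w a, OF dfd[OF seg]])
    have "?A ((s *\<^sub>R w) # replicate m w) = s * a"
      using linear_scale[OF forms_linear[OF nabla_forms[OF A]]] by (simp add: a_def)
    with dinc[OF seg, of s "replicate m w"] s
    have "\<bar>nabla m f (x + s *\<^sub>R w) (replicate m w) - nabla m f x (replicate m w) - s * a\<bar>
        \<le> s * (e * norm w ^ Suc m)" by (simp add: prod_list_replicate mult_ac)
    also have "\<dots> \<le> e * norm w ^ Suc m"
      using s e by (intro mult_left_le_one_le) auto
    also have "\<dots> \<le> e * norm w ^ Suc m * fact m"
      using e fact_ge_1[of m] mult_left_mono[OF fact_ge_1[of m], of "e * norm w ^ Suc m"] by simp
    finally show ?case
      using eq by (simp add: a_def pos_divide_le_eq algebra_simps del: fact_Suc)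
  qed
qed

section \<open>The lower derivatives\<close>

lemma length_nablas [simp]: "length (nablas k f x) = k"
  by (simp add: nablas_def)

lemma nablas_nth: "i < k \<Longrightarrow> nablas k f x ! i = nabla (Suc i) f x"
  by (simp add: nablas_def del: upt_Suc)

lemma take_nablas: "i \<le> k \<Longrightarrow> take i (nablas k f x) = nablas i f x"
  by (rule nth_equalityI) (auto simp: nablas_nth)

lemma fst_tendsto_0: "filterlim fst (nhds (0 :: real)) (at_right 0 \<times>\<^sub>F F)"
  by (rule filterlim_mono[OF filterlim_fst _ order_refl]) (simp add: at_within_def)

text \<open>
  Taylor's formula at \<open>w = t *\<^sub>R u'\<close>, divided by \<open>t ^ Suc m / fact (Suc m)\<close>: by homogeneity the term
  of order \<open>Suc m\<close> becomes the derivative on the diagonal at \<open>u'\<close>, which is continuous in \<open>u'\<close>.  The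
  remainder vanishes since \<open>u'\<close> stays bounded, so \<open>norm w ^ Suc m\<close> is of order \<open>t ^ Suc m\<close>.
\<close>

lemma difference_quotient_tendsto:
  assumes A: "frechet_differentiable (Suc m) f x"
  shows "((\<lambda>(t, u'). fact (Suc m) / t ^ Suc m * (nabla 0 f (x + t *\<^sub>R u') [] - nabla 0 f x []
      - (\<Sum>i=1..m. t ^ i / fact i * nabla i f x (replicate i u'))))
    \<longlongrightarrow> nabla (Suc m) f x (replicate (Suc m) u)) (at_right 0 \<times>\<^sub>F nhds u)"
proof -
  let ?F = "at_right (0 :: real) \<times>\<^sub>F nhds u" and ?N = "\<lambda>k. nabla k f x"
  define R where "R = (\<lambda>w. nabla 0 f (x + w) [] - (\<Sum>k\<le>Suc m. ?N k (replicate k w) / fact k))"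
  have forms: "?N k \<in> forms k" if "k \<le> Suc m" for k
    using frechet_differentiable_mono[OF A that] by (rule nabla_forms)
  note fst0 = fst_tendsto_0[of "nhds u"]
  have snd: "filterlim snd (nhds u) ?F" by (rule filterlim_snd)
  have lim0: "filterlim (\<lambda>p. fst p *\<^sub>R snd p) (nhds 0) ?F"
    using tendsto_scaleR[OF fst0 snd] by simp
  have pos: "\<forall>\<^sub>F p in ?F. fst p > 0"
    by (rule eventually_compose_filterlim[OF _ filterlim_fst]) (simp add: eventually_at_right_less)
  have "(\<lambda>p. R (fst p *\<^sub>R snd p)) \<in> o[?F](\<lambda>p. norm (fst p *\<^sub>R snd p) ^ Suc m)"
    using landau_o.small.compose[OF Taylor_Peano[OF A] lim0] by (simp add: R_def)
  also have "(\<lambda>p. norm (fst p *\<^sub>R snd p) ^ Suc m) \<in> O[?F](\<lambda>p. fst p ^ Suc m)"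
  proof (rule landau_o.bigI)
    have "\<forall>\<^sub>F p in ?F. norm (snd p) < norm u + 1"
      using order_tendstoD(2)[OF tendsto_norm[OF snd], of "norm u + 1"] by simp
    then show "\<forall>\<^sub>F p in ?F. norm (norm (fst p *\<^sub>R snd p) ^ Suc m) \<le> (norm u + 1) ^ Suc m * norm (fst p ^ Suc m)"
    proof eventually_elim
      case (elim p)
      then have "norm (snd p) ^ Suc m \<le> (norm u + 1) ^ Suc m" by (intro power_mono) auto
      from mult_left_mono[OF this, of "\<bar>fst p\<bar> ^ Suc m"] show ?case
        by (simp add: power_mult_distrib power_abs abs_mult mult_ac)
    qed
  qed (use norm_ge_zero[of u] in \<open>simp add: add_nonneg_pos\<close>)
  finally have "((\<lambda>p. R (fst p *\<^sub>R snd p) / fst p ^ Suc m) \<longlongrightarrow> 0) ?F"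
    by (rule smalloD_tendsto)
  moreover have "((\<lambda>p. ?N (Suc m) (replicate (Suc m) (snd p))) \<longlongrightarrow> ?N (Suc m) (replicate (Suc m) u)) ?F"
    using isCont_tendsto_compose[OF forms_diagonal_isCont[OF forms[OF order_refl]] snd] .
  ultimately have "((\<lambda>p. ?N (Suc m) (replicate (Suc m) (snd p)) + fact (Suc m) * (R (fst p *\<^sub>R snd p) / fst p ^ Suc m))
      \<longlongrightarrow> ?N (Suc m) (replicate (Suc m) u) + fact (Suc m) * 0) ?F"
    by (intro tendsto_intros)
  moreover have "\<forall>\<^sub>F p in ?F. ?N (Suc m) (replicate (Suc m) (snd p))
        + fact (Suc m) * (R (fst p *\<^sub>R snd p) / fst p ^ Suc m)
      = (case p of (t, u') \<Rightarrow> fact (Suc m) / t ^ Suc m * (nabla 0 f (x + t *\<^sub>R u') [] - nabla 0 f x []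
          - (\<Sum>i=1..m. t ^ i / fact i * ?N i (replicate i u'))))"
    using pos
  proof eventually_elim
    case (elim p)
    obtain t u' where p: "p = (t, u')" by (cases p)
    let ?S = "\<Sum>i=1..m. t ^ i / fact i * ?N i (replicate i u')"
      and ?L = "?N (Suc m) (replicate (Suc m) u')"
    have "(\<Sum>k\<le>Suc m. ?N k (replicate k (t *\<^sub>R u')) / fact k)
        = (\<Sum>k\<le>Suc m. t ^ k / fact k * ?N k (replicate k u'))"
      using forms by (intro sum.cong) (auto simp: forms_diagonal_scaleR simp del: replicate.simps forms.simps)
    also have "\<dots> = nabla 0 f x [] + ?S + t ^ Suc m / fact (Suc m) * ?L"
      by (simp add: atMost_atLeast0 sum.atLeast_Suc_atMost del: power_Suc fact_Suc replicate.simps) simp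
    finally have "R (t *\<^sub>R u') = nabla 0 f (x + t *\<^sub>R u') [] - nabla 0 f x [] - ?S
        - t ^ Suc m / fact (Suc m) * ?L"
      unfolding R_def by simp
    then show ?case
      using elim by (simp add: p field_simps del: power_Suc fact_Suc replicate.simps)
  qed
  ultimately show ?thesis
    by (auto intro: Lim_transform_eventually)
qed

text \<open>
  The derivative of order \<open>Suc m\<close> forces \<open>f\<close> to be finite near \<open>x\<close>, so that near the limit point
  the extended real difference quotients are real ones.
\<close>

theorem lower_deriv_nablas:
  assumes A: "frechet_differentiable (Suc m) f x"
  shows "lower_deriv f x (nablas m f x) u = ereal (nabla (Suc m) f x (replicate (Suc m) u))"
proof -
  let ?F = "at_right (0 :: real) \<times>\<^sub>F nhds u"
  let ?q = "\<lambda>(t, u'). fact (Suc m) / t ^ Suc m * (nabla 0 f (x + t *\<^sub>R u') [] - nabla 0 f x []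
      - (\<Sum>i=1..m. t ^ i / fact i * nabla i f x (replicate i u')))"
  from tendsto_add[OF tendsto_const[of x] tendsto_scaleR[OF fst_tendsto_0 filterlim_snd]]
  have "filterlim (\<lambda>p. x + fst p *\<^sub>R snd p) (nhds x) ?F" by simp
  moreover have "\<forall>\<^sub>F y in nhds x. frechet_differentiable m f y"
    using has_nabla_nabla[OF A] by (simp add: has_nabla_Suc_iff del: has_nabla.simps)
  ultimately have ev: "\<forall>\<^sub>F p in ?F. frechet_differentiable m f (x + fst p *\<^sub>R snd p)"
    by (rule eventually_compose_filterlim[rotated])
  have sum: "(\<Sum>i=1..m. t ^ i / fact i * (nablas m f x ! (i - 1)) (replicate i v))
      = (\<Sum>i=1..m. t ^ i / fact i * nabla i f x (replicate i v))" for t v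
    by (intro sum.cong) (auto simp: nablas_nth)
  have "lower_deriv f x (nablas m f x) u = Liminf ?F (\<lambda>p. ereal (?q p))"
    unfolding lower_deriv_def Let_def length_nablas diff_Suc_1 sum
  proof (rule Liminf_eq, use ev in eventually_elim)
    case (elim p)
    then show ?case
      using frechet_differentiable_finite[OF elim] frechet_differentiable_finite[OF A]
      by (cases p) simp
  qed
  also have "\<dots> = ereal (nabla (Suc m) f x (replicate (Suc m) u))"
    using difference_quotient_tendsto[OF A, of u]
    by (intro lim_imp_Liminf) (auto simp: prod_filter_eq_bot)
  finally show ?thesis .
qed

lemma nabla_in_lower_subdiff:
  assumes "frechet_differentiable (Suc m) f x"
  shows "nabla (Suc m) f x \<in> lower_subdiff f x (nablas m f x)"
  using nabla_forms[OF assms] lower_deriv_nablas[OF assms]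
  by (simp add: lower_subdiff_def del: forms.simps replicate.simps)

lemma first_order_lower_subdiff:
  assumes D: "frechet_differentiable 1 f x"
  shows "lower_subdiff f x [] = {nabla 1 f x}"
proof
  let ?N = "nabla 1 f x"
  have nil: "nablas 0 f x = []" by (simp add: nablas_def)
  show "{?N} \<subseteq> lower_subdiff f x []"
    using nabla_in_lower_subdiff[of 0 f x] D by (simp add: nil)
  show "lower_subdiff f x [] \<subseteq> {?N}"
  proof
    fix B assume "B \<in> lower_subdiff f x []"
    then have B: "B \<in> forms 1" and le: "B [u] \<le> ?N [u]" for u
      using lower_deriv_nablas[of 0 f x] D
      by (auto simp: lower_subdiff_def nil simp del: forms.simps)
    have N: "?N \<in> forms 1" by (rule nabla_forms[OF D])
    have neg: "C [- u] = - C [u]" if "C \<in> forms 1" for C :: "'a form" and u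
      using linear_neg[OF forms_linear[of C 0 "[]"]] that by simp
    have "B us = ?N us" for us
    proof (cases "length us = 1")
      case True
      then obtain u where us: "us = [u]" by (auto simp: length_Suc_conv)
      show ?thesis
        using le[of u] le[of "- u"] neg[OF B, of u] neg[OF N, of u] unfolding us by linarith
    qed (use forms_zero B N in metis)
    then show "B \<in> {?N}" by auto
  qed
qed

lemma lower_deriv_exists_nablas:
  assumes D: "frechet_differentiable m f x"
  shows "lower_deriv_exists f x (nablas m f x)"
  unfolding lower_deriv_exists_def
proof (intro conjI allI impI)
  show "x \<in> eff_dom f"
    by (simp add: eff_dom_def frechet_differentiable_finite[OF D])
  fix i assume "i < length (nablas m f x)"
  then show "nablas m f x ! i \<in> lower_subdiff f x (take i (nablas m f x))"
    using nabla_in_lower_subdiff[OF frechet_differentiable_mono[OF D, of "Suc i"]]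
    by (simp add: nablas_nth take_nablas)
qed

theorem proposition2p7:
  fixes f :: "'a::euclidean_space \<Rightarrow> ereal" and x :: 'a and n :: nat
  assumes "1 \<le> n"
    and "proper_fun f"
    and "\<forall>\<^sub>F y in nhds x. \<forall>m\<in>{1..n - 1}. frechet_differentiable m f y"
    and "frechet_differentiable n f x"
  shows "(\<forall>m\<in>{1..n}. lower_deriv_exists f x (nablas (m - 1) f x)) \<and>
    (\<forall>u. lower_deriv f x [] u = ereal (nabla 1 f x [u])) \<and>
    lower_subdiff f x [] = {nabla 1 f x} \<and>
    (\<forall>m\<in>{2..n}. \<forall>u. lower_deriv f x (nablas (m - 1) f x) u = ereal (nabla m f x (replicate m u))) \<and>
    (\<forall>m\<in>{2..n}. nabla m f x \<in> lower_subdiff f x (nablas (m - 1) f x))"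
proof -
  have D: "frechet_differentiable m f x" if "m \<le> n" for m
    using frechet_differentiable_mono[OF assms(4) that] .
  have eq: "lower_deriv f x (nablas (m - 1) f x) u = ereal (nabla m f x (replicate m u))"
    and sub: "nabla m f x \<in> lower_subdiff f x (nablas (m - 1) f x)" if "1 \<le> m" "m \<le> n" for m u
  proof -
    have "frechet_differentiable (Suc (m - 1)) f x" using D that by simp
    from lower_deriv_nablas[OF this] nabla_in_lower_subdiff[OF this]
    show "lower_deriv f x (nablas (m - 1) f x) u = ereal (nabla m f x (replicate m u))"
      and "nabla m f x \<in> lower_subdiff f x (nablas (m - 1) f x)"
      using that by simp_all
  qed
  have "lower_deriv f x [] u = ereal (nabla 1 f x [u])" for u
    using eq[of 1 u] assms(1) by (simp add: nablas_def)
  moreover have "lower_subdiff f x [] = {nabla 1 f x}"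
    using D assms(1) by (intro first_order_lower_subdiff)
  ultimately show ?thesis
    using eq sub lower_deriv_exists_nablas[OF D] by auto
qed

end
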